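(* Let $T>0$, $p\ge1$ an integer, $N_t\ge1$, $h_t=T/N_t$, $\mu_s\in\mathbb R$, and let $f=f_r+\mathrm i f_i\in L^2(0,T)$ with real-valued $f_r,f_i$. Then $\psi_{h_t}^p=u_{h_t}^p+\mathrm i v_{h_t}^p\in S^p_{h_t}(0,T;\mathbb C)$ (with $u^p_{h_t},v^p_{h_t}$ real-valued) is a solution of the problem $$\text{find } \psi_{h_t}^p\in S^p_{h_t,0,\bullet}(0,T;\mathbb C):\quad \mathrm i(\partial_t\psi_{h_t}^p,w)_{J_T}+\mu_s(\psi_{h_t}^p,w)_{J_T}=(f,w)_{J_T}\quad\forall\,w\in S^{p-1}_{h_t}(0,T;\mathbb C)$$ if and only if the real-valued functions $u_{h_t}^p\in S^p_{h_t,0,\bullet}(0,T;\mathbb R)$ and $v_{h_t}^p\in S^p_{h_t,0,\bullet}(0,T;\mathbb R)$ satisfy $$\begin{cases}(\partial_t u_{h_t}^p,\chi)_{J_T}+\mu_s(v_{h_t}^p,\chi)_{J_T}=(f_i,\chi)_{J_T}&\forall\,\chi\in S^{p-1}_{h_t}(0,T;\mathbb R),\\(\partial_t v_{h_t}^p,\lambda)_{J_T}-\mu_s(u_{h_t}^p,\lambda)_{J_T}=-(f_r,\lambda)_{J_T}&\forall\,\lambda\in S^{p-1}_{h_t}(0,T;\mathbb R),\end{cases}$$ or, equivalently, $$\begin{cases}(\partial_t u_{h_t}^p,\partial_t\chi)_{J_T}-\mu_s(\partial_t v_{h_t}^p,\chi)_{J_T}=(f_i,\partial_t\chi)_{J_T}&\forall\,\chi\in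 S^{p}_{h_t,\bullet,0}(0,T;\mathbb R),\\(\partial_t v_{h_t}^p,\partial_t\lambda)_{J_T}+\mu_s(\partial_t u_{h_t}^p,\lambda)_{J_T}=-(f_r,\partial_t\lambda)_{J_T}&\forall\,\lambda\in S^{p}_{h_t,\bullet,0}(0,T;\mathbb R).\end{cases}$$
   Context: $J_T=(0,T)$, $(u,v)_{J_T}=\int_0^T u\,\overline v\,dt$, $t_j=jh_t$ for $j=0,\dots,N_t$. For $q\ge 0$ and $\mathbb K\in\{\mathbb R,\mathbb C\}$, $S^q_{h_t}(0,T;\mathbb K)$ is the space of $\mathbb K$-valued functions that are polynomials of degree at most $q$ on each $(t_{j-1},t_j)$, $j=1,\dots,N_t$, and belong to $C^{q-1}([0,T])$ (no continuity is required when $q=0$). $S^q_{h_t,0,\bullet}$ and $S^q_{h_t,\bullet,0}$ denote the subspaces of functions vanishing at $t=0$ and at $t=T$, respectively. *)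

theory Defs
  imports "HOL-Analysis.Analysis"
begin

text \<open>Membership in $L^2(0,T)$ for a representative, with respect to Lebesgue measure.\<close>

definition L2_on :: "real \<Rightarrow> (real \<Rightarrow> complex) \<Rightarrow> bool" where
  "L2_on T f \<longleftrightarrow>
     set_borel_measurable lebesgue {0<..<T} f \<and>
     set_integrable lebesgue {0<..<T} (\<lambda>t. (norm (f t))\<^sup>2)"

definition ipC :: "real \<Rightarrow> (real \<Rightarrow> complex) \<Rightarrow> (real \<Rightarrow> complex) \<Rightarrow> complex" where
  "ipC T u v = set_lebesgue_integral lebesgue {0<..<T} (\<lambda>t. u t * cnj (v t))"

definition ipR :: "real \<Rightarrow> (real \<Rightarrow> real) \<Rightarrow> (real \<Rightarrow> real) \<Rightarrow> real" where
  "ipR T u v = set_lebesgue_integral lebesgue {0<..<T} (\<lambda>t. u t * v t)"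

text \<open>The derivative is taken within $[0,T]$, so it is one-sided at the end points and
  independent of the values of the function outside $[0,T]$. For a continuous piecewise
  polynomial it represents the weak derivative; at the finitely many nodes where a spline
  of degree 1 is not differentiable its value is unspecified, which no integral sees.\<close>

definition dt :: "real \<Rightarrow> (real \<Rightarrow> 'a::real_normed_vector) \<Rightarrow> real \<Rightarrow> 'a" where
  "dt T u t = vector_derivative u (at t within {0..T})"

text \<open>\<open>Ck_on k S f\<close>: \<open>f\<close> is \<open>k\<close> times continuously differentiable on \<open>S\<close>
  (derivatives within \<open>S\<close>).\<close>

primrec Ck_on :: "nat \<Rightarrow> real set \<Rightarrow> (real \<Rightarrow> 'a::real_normed_vector) \<Rightarrow> bool" where
  "Ck_on 0 S f \<longleftrightarrow> continuous_on S f"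
| "Ck_on (Suc k) S f \<longleftrightarrow>
     (\<exists>f'. (\<forall>t\<in>S. (f has_vector_derivative f' t) (at t within S)) \<and> Ck_on k S f')"

definition node :: "real \<Rightarrow> nat \<Rightarrow> nat \<Rightarrow> real" where
  "node T N j = real j * (T / real N)"

text \<open>The spline space $S^q_{h}(0,T;K)$ with $h = T/N$, for $K$ the reals or the complex
  numbers. Its elements are total functions of which only the values on $[0,T]$ matter;
  for $q = 0$ the values at the nodes are arbitrary.\<close>

definition spline :: "real \<Rightarrow> nat \<Rightarrow> nat \<Rightarrow> (real \<Rightarrow> 'a::real_normed_field) set" where
  "spline T N q =
     {f. (\<forall>j\<in>{1..N}. \<exists>P :: 'a poly. degree P \<le> q \<and>
            (\<forall>t\<in>{node T N (j - 1)<..<node T N j}. f t = poly P (of_real t))) \<and>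
         (q > 0 \<longrightarrow> Ck_on (q - 1) {0..T} f)}"

definition spline_init :: "real \<Rightarrow> nat \<Rightarrow> nat \<Rightarrow> (real \<Rightarrow> 'a::real_normed_field) set" where
  "spline_init T N q = {f \<in> spline T N q. f 0 = 0}"

definition spline_final :: "real \<Rightarrow> nat \<Rightarrow> nat \<Rightarrow> (real \<Rightarrow> 'a::real_normed_field) set" where
  "spline_final T N q = {f \<in> spline T N q. f T = 0}"

definition complex_solution ::
    "real \<Rightarrow> nat \<Rightarrow> nat \<Rightarrow> real \<Rightarrow> (real \<Rightarrow> complex) \<Rightarrow> (real \<Rightarrow> complex) \<Rightarrow> bool" where
  "complex_solution T N p \<mu> f \<psi> \<longleftrightarrow>
     \<psi> \<in> spline_init T N p \<and>
     (\<forall>w \<in> spline T N (p - 1).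
        \<i> * ipC T (dt T \<psi>) w + complex_of_real \<mu> * ipC T \<psi> w = ipC T f w)"

definition real_solution ::
    "real \<Rightarrow> nat \<Rightarrow> nat \<Rightarrow> real \<Rightarrow> (real \<Rightarrow> real) \<Rightarrow> (real \<Rightarrow> real) \<Rightarrow>
     (real \<Rightarrow> real) \<Rightarrow> (real \<Rightarrow> real) \<Rightarrow> bool" where
  "real_solution T N p \<mu> f_r f_i u v \<longleftrightarrow>
     u \<in> spline_init T N p \<and> v \<in> spline_init T N p \<and>
     (\<forall>x \<in> spline T N (p - 1). ipR T (dt T u) x + \<mu> * ipR T v x = ipR T f_i x) \<and>
     (\<forall>y \<in> spline T N (p - 1). ipR T (dt T v) y - \<mu> * ipR T u y = - ipR T f_r y)"

definition real_solution_dt ::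
    "real \<Rightarrow> nat \<Rightarrow> nat \<Rightarrow> real \<Rightarrow> (real \<Rightarrow> real) \<Rightarrow> (real \<Rightarrow> real) \<Rightarrow>
     (real \<Rightarrow> real) \<Rightarrow> (real \<Rightarrow> real) \<Rightarrow> bool" where
  "real_solution_dt T N p \<mu> f_r f_i u v \<longleftrightarrow>
     u \<in> spline_init T N p \<and> v \<in> spline_init T N p \<and>
     (\<forall>x \<in> spline_final T N p.
        ipR T (dt T u) (dt T x) - \<mu> * ipR T (dt T v) x = ipR T f_i (dt T x)) \<and>
     (\<forall>y \<in> spline_final T N p.
        ipR T (dt T v) (dt T y) + \<mu> * ipR T (dt T u) y = - ipR T f_r (dt T y))"

end

theory Submission
  imports Defs
begin

text \<open>Testing the complex equation against real splines and separating real and imaginary parts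
  gives the first system; conversely the complex pairing with \<open>w\<close> is a complex combination of real
  pairings with \<open>Re w\<close> and \<open>Im w\<close>. For the second system, differentiation maps the
  splines of degree \<open>p\<close> vanishing at \<open>T\<close> onto those of degree \<open>p - 1\<close> (up to node values),
  the preimage being the primitive \<open>- \<integral>\<^sub>t\<^sup>T\<close>, and integration by parts has no boundary terms
  because the trial functions vanish at \<open>0\<close> and the test functions at \<open>T\<close>.\<close>

section \<open>Splines away from the nodes\<close>

abbreviation nodes :: "real \<Rightarrow> nat \<Rightarrow> real set" where
  "nodes T N \<equiv> node T N ` {0..N}"

abbreviation piece :: "real \<Rightarrow> nat \<Rightarrow> nat \<Rightarrow> real set" where
  "piece T N j \<equiv> {node T N (j - 1)<..<node T N j}"

text \<open>The index of the piece containing \<open>t\<close>, by an explicit floor formula because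
  measurability of this index is needed below. The \<open>+ 1\<close> reflects that pieces are
  numbered from 1.\<close>

definition piece_index :: "real \<Rightarrow> nat \<Rightarrow> real \<Rightarrow> nat" where
  "piece_index T N t = nat \<lfloor>t / (T / real N)\<rfloor> + 1"

lemma piece_index:
  assumes "T > 0" "N \<ge> 1" "t \<in> {0<..<T} - nodes T N"
  shows "piece_index T N t \<in> {1..N}" "t \<in> piece T N (piece_index T N t)"
proof -
  define h where "h = T / real N"
  have h: "h > 0" "T = N * h" using assms by (auto simp: h_def)
  define k where "k = nat \<lfloor>t / h\<rfloor>"
  have "t / h > 0" using assms h by auto
  then have k: "real k \<le> t / h" "t / h < real k + 1"
    by (auto simp: k_def le_floor_iff floor_less_iff)
  then have k': "real k * h \<le> t" "t < (real k + 1) * h"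
    using h by (auto simp: field_simps)
  have "real k * h < real N * h" using k'(1) assms(3) h(2) by auto
  then have kN: "k < N" using h(1) by (simp only: mult_less_cancel_right_pos of_nat_less_iff)
  \<comment> \<open>The floor gives only \<open>k * h \<le> t\<close>; avoiding the nodes makes this
    strict, so \<open>t\<close> lies in the open piece \<open>k + 1\<close>.\<close>
  have "t \<noteq> node T N k" using assms kN by auto
  then have "t \<noteq> real k * h" by (simp add: node_def h_def)
  then show "piece_index T N t \<in> {1..N}" "t \<in> piece T N (piece_index T N t)"
    using k' kN by (auto simp: piece_index_def node_def simp flip: h_def k_def)
      (simp add: algebra_simps)+
qed

lemma piece_subset:
  assumes "T > 0" "j \<in> {1..N}"
  shows "piece T N j \<subseteq> {0<..<T}"
proof -
  have "real j \<le> real N" "real (j - 1) \<ge> 0" using assms by auto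
  then have "node T N j \<le> T" "0 \<le> node T N (j - 1)"
    using assms by (auto simp: node_def field_simps)
  then show ?thesis by auto
qed

text \<open>Derivatives within \<open>S\<close> see only values on \<open>S\<close>. This matters
  because splines are total functions that are meaningful on \<open>[0,T]\<close> alone.\<close>

lemma Ck_on_cong:
  assumes "\<And>t. t \<in> S \<Longrightarrow> f t = g t"
  shows "Ck_on k S f \<longleftrightarrow> Ck_on k S g"
  using assms
proof (induction k arbitrary: f g)
  case 0
  then show ?case by (auto cong: continuous_on_cong)
next
  case (Suc k)
  then have "(f has_vector_derivative d) (at t within S) \<longleftrightarrow> (g has_vector_derivative d) (at t within S)"
    if "t \<in> S" for t d
    using that Suc.prems has_vector_derivative_transform[of t S f g] has_vector_derivative_transform[of t S g f]
    by auto
  then show ?case by simp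
qed

lemma Ck_on_imp_continuous_on: "Ck_on k S f \<Longrightarrow> continuous_on S f"
  by (cases k) (auto simp: continuous_on_eq_continuous_within intro: has_vector_derivative_continuous)

lemma spline_cong:
  assumes "T > 0" "\<And>t. t \<in> {0..T} \<Longrightarrow> f t = g t"
  shows "f \<in> spline T N q \<longleftrightarrow> g \<in> spline T N q"
proof -
  have "f t = g t" if "j \<in> {1..N}" "t \<in> piece T N j" for j t
    using piece_subset[OF assms(1) that(1)] that assms(2) by force
  then show ?thesis
    using Ck_on_cong[of "{0..T}" f g, OF assms(2)] by (simp add: spline_def)
qed

lemma spline_piece:
  assumes "f \<in> spline T N q" "j \<in> {1..N}"
  obtains P where "degree P \<le> q" "\<And>t. t \<in> piece T N j \<Longrightarrow> f t = poly P (of_real t)"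
  using assms unfolding spline_def by blast

lemma spline_continuous_on: "f \<in> spline T N q \<Longrightarrow> q > 0 \<Longrightarrow> continuous_on {0..T} f"
  by (auto simp: spline_def dest: Ck_on_imp_continuous_on)

section \<open>Differentiation of splines\<close>

lemma poly_has_vector_derivative:
  fixes P :: "'a::real_normed_field poly"
  shows "((\<lambda>t. poly P (of_real t)) has_vector_derivative poly (pderiv P) (of_real t)) (at t within S)"
  by (intro has_vector_derivative_real_field poly_DERIV)

lemma dt_eqI:
  fixes f :: "real \<Rightarrow> 'a::euclidean_space"
  assumes "T > 0" "t \<in> {0..T}" "(f has_vector_derivative d) (at t within {0..T})"
  shows "dt T f t = d"
  using assms unfolding dt_def by (intro vector_derivative_within_closed_interval)

text \<open>The piece is open, so \<open>f\<close> agrees with \<open>P\<close> on a neighbourhood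
  of \<open>t\<close>; the two-sided derivative then restricts to the one within
  \<open>[0,T]\<close> that \<open>dt\<close> selects.\<close>

lemma has_vector_derivative_on_piece:
  fixes f :: "real \<Rightarrow> 'a::{real_normed_field,euclidean_space}"
  assumes T: "T > 0" and j: "j \<in> {1..N}"
    and P: "\<And>t. t \<in> piece T N j \<Longrightarrow> f t = poly P (of_real t)"
    and t: "t \<in> piece T N j"
  shows "(f has_vector_derivative poly (pderiv P) (of_real t)) (at t)"
    and "dt T f t = poly (pderiv P) (of_real t)"
proof -
  show *: "(f has_vector_derivative poly (pderiv P) (of_real t)) (at t)"
    by (rule has_vector_derivative_transform_within_open[OF poly_has_vector_derivative _ t])
      (use P in auto)
  show "dt T f t = poly (pderiv P) (of_real t)"
    using piece_subset[OF T j] t T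
    by (intro dt_eqI has_vector_derivative_at_within[OF *]) auto
qed

lemma spline_has_vector_derivative:
  fixes f :: "real \<Rightarrow> 'a::{real_normed_field,euclidean_space}"
  assumes "T > 0" "N \<ge> 1" "f \<in> spline T N q" "t \<in> {0<..<T} - nodes T N"
  shows "(f has_vector_derivative dt T f t) (at t)"
proof -
  note pi = piece_index[OF assms(1,2,4)]
  obtain P where "\<And>s. s \<in> piece T N (piece_index T N t) \<Longrightarrow> f s = poly P (of_real s)"
    using spline_piece[OF assms(3) pi(1)] by blast
  then show ?thesis
    using has_vector_derivative_on_piece[OF assms(1) pi(1), of f P t] pi(2) by simp
qed

text \<open>On each piece the polynomial is replaced by \<open>pderiv P\<close>, which lowers the
  degree bound. For \<open>p > 1\<close> the derivative exists on all of \<open>[0,T]\<close> and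
  inherits one order of smoothness less; for \<open>p = 1\<close> smoothness demands
  nothing.\<close>

lemma dt_in_spline:
  fixes f :: "real \<Rightarrow> 'a::{real_normed_field,euclidean_space}"
  assumes T: "T > 0" and p: "p \<ge> 1" and f: "f \<in> spline T N p"
  shows "dt T f \<in> spline T N (p - 1)"
proof -
  have "\<exists>P :: 'a poly. degree P \<le> p - 1 \<and> (\<forall>t\<in>piece T N j. dt T f t = poly P (of_real t))"
    if j: "j \<in> {1..N}" for j
  proof -
    obtain P where P: "degree P \<le> p" "\<And>t. t \<in> piece T N j \<Longrightarrow> f t = poly P (of_real t)"
      using spline_piece[OF f j] by blast
    have "degree (pderiv P) \<le> p - 1"
      using P by (simp add: degree_pderiv)
    then show ?thesis
      using has_vector_derivative_on_piece(2)[OF T j, of f P] P by blast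
  qed
  moreover have "Ck_on (p - 1 - 1) {0..T} (dt T f)" if p1: "p - 1 > 0"
  proof -
    have "Ck_on (p - 1) {0..T} f" using f p by (auto simp: spline_def)
    \<comment> \<open>Exposing a successor yields a derivative \<open>f'\<close> valid at the nodes
      and end points as well; by uniqueness \<open>dt\<close> coincides with it on
      \<open>[0,T]\<close>.\<close>
    then have "Ck_on (Suc (p - 1 - 1)) {0..T} f" using p1 by (metis Suc_diff_1)
    then obtain f' where f': "\<forall>t\<in>{0..T}. (f has_vector_derivative f' t) (at t within {0..T})"
      and ck: "Ck_on (p - 1 - 1) {0..T} f'" by auto
    have "dt T f t = f' t" if "t \<in> {0..T}" for t
      using T that f' by (intro dt_eqI) auto
    then show ?thesis using ck Ck_on_cong[of "{0..T}" "dt T f" f'] by blast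
  qed
  ultimately show ?thesis unfolding spline_def by blast
qed

section \<open>Integrals over the time interval\<close>

text \<open>Finite sets are Lebesgue null. This discards the node values, where \<open>dt\<close>
  may be unspecified and splines of degree 0 are arbitrary.\<close>

lemma set_integral_finite_difference:
  fixes f g :: "real \<Rightarrow> 'a::{banach,second_countable_topology}"
  assumes "finite X" "\<And>t. t \<in> S - X \<Longrightarrow> f t = g t"
  shows "set_integrable lebesgue S f \<longleftrightarrow> set_integrable lebesgue S g"
    and "set_lebesgue_integral lebesgue S f = set_lebesgue_integral lebesgue S g"
proof -
  have *: "countable X" "\<And>t. t \<in> X \<Longrightarrow> emeasure lebesgue {t} = 0" "\<And>t. t \<in> X \<Longrightarrow> {t} \<in> sets lebesgue"
    "\<And>t. t \<in> space lebesgue \<Longrightarrow> t \<notin> X \<Longrightarrow> indicator S t *\<^sub>R f t = indicator S t *\<^sub>R g t"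
    using assms by (auto simp: indicator_def countable_finite)
  show "set_integrable lebesgue S f \<longleftrightarrow> set_integrable lebesgue S g"
    unfolding set_integrable_def by (rule integrable_discrete_difference[OF *])
  show "set_lebesgue_integral lebesgue S f = set_lebesgue_integral lebesgue S g"
    unfolding set_lebesgue_integral_def by (rule integral_discrete_difference[OF *])
qed

lemma set_integrable_const: "set_integrable lebesgue {a<..<b::real} (\<lambda>t. c :: real)"
  unfolding set_integrable_def by (intro integrable_scaleR_left integrable_real_indicator)
    (use emeasure_lborel_box_finite[of a b] in auto)

text \<open>Off the nodes a spline is bounded and agrees with a Borel function, and such a factor
  preserves integrability.\<close>

lemma set_integrable_mult_spline:
  fixes g w :: "real \<Rightarrow> real"
  assumes T: "T > 0" "N \<ge> 1" and g: "set_integrable lebesgue {0<..<T} g" and w: "w \<in> spline T N q"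
  shows "set_integrable lebesgue {0<..<T} (\<lambda>t. g t * w t)"
proof -
  have "\<exists>P. \<forall>t\<in>piece T N j. w t = poly P t" if "j \<in> {1..N}" for j
    using spline_piece[OF w that] by (metis of_real_eq_id id_apply)
  then obtain P where P: "\<And>j t. j \<in> {1..N} \<Longrightarrow> t \<in> piece T N j \<Longrightarrow> w t = poly (P j) t"
    by metis
  \<comment> \<open>\<open>G\<close> glues the polynomial pieces by a formula on the whole line, so
    it is Borel, whereas \<open>w\<close> is uncontrolled outside \<open>[0,T]\<close>.\<close>
  define G where "G t = poly (P (piece_index T N t)) t" for t
  have wG: "w t = G t" if "t \<in> {0<..<T} - nodes T N" for t
    using piece_index[OF T that] P by (auto simp: G_def)
  \<comment> \<open>The sum of all \<open>\<bar>poly (P j) t\<bar>\<close> dominates every single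
    piece and is continuous on a compact interval, which gives one bound \<open>C\<close> for all
    pieces.\<close>
  have "continuous_on {0..T} (\<lambda>t. \<Sum>j\<in>{1..N}. \<bar>poly (P j) t\<bar>)"
    by (intro continuous_intros)
  then have "bounded ((\<lambda>t. \<Sum>j\<in>{1..N}. \<bar>poly (P j) t\<bar>) ` {0..T})"
    by (intro compact_imp_bounded compact_continuous_image) auto
  then obtain C where C: "\<And>t. t \<in> {0..T} \<Longrightarrow> \<bar>\<Sum>j\<in>{1..N}. \<bar>poly (P j) t\<bar>\<bar> \<le> C"
    unfolding bounded_iff real_norm_def by blast
  have GC: "\<bar>G t\<bar> \<le> C" if t: "t \<in> {0<..<T} - nodes T N" for t
  proof -
    have "\<bar>G t\<bar> \<le> (\<Sum>j\<in>{1..N}. \<bar>poly (P j) t\<bar>)"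
      unfolding G_def
      by (rule member_le_sum[of _ _ "\<lambda>j. \<bar>poly (P j) t\<bar>"]) (use piece_index[OF T t] in auto)
    also have "\<dots> \<le> C" using C[of t] t by auto
    finally show ?thesis .
  qed
  have floor: "(\<lambda>t. \<lfloor>t / (T / real N)\<rfloor>) \<in> measurable borel (count_space UNIV)"
    by (rule measurable_compose[OF _ measurable_real_floor]) simp
  have "(\<lambda>k::int. nat k + 1) \<in> measurable (count_space UNIV) (count_space UNIV)"
    by simp
  from measurable_compose[OF floor this]
  have "piece_index T N \<in> measurable borel (count_space UNIV)"
    unfolding piece_index_def[abs_def] .
  moreover have "(\<lambda>t. poly (P j) t) \<in> borel_measurable borel" for j
    by (intro borel_measurable_continuous_onI continuous_intros)
  \<comment> \<open>A measurable index with countably many values selects among measurable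
    branches.\<close>
  ultimately have "G \<in> borel_measurable borel"
    unfolding G_def[abs_def] by (rule measurable_compose_countable[rotated])
  then have G: "G \<in> borel_measurable lebesgue"
    by (intro measurable_completion) simp
  have "set_integrable lebesgue {0<..<T} (\<lambda>t. g t * G t)"
  proof (rule set_integrable_bound)
    show "set_integrable lebesgue {0<..<T} (\<lambda>t. C * g t)"
      using g by simp
    show "set_borel_measurable lebesgue {0<..<T} (\<lambda>t. g t * G t)"
      using borel_measurable_times[OF borel_measurable_integrable[OF g[unfolded set_integrable_def]] G]
      by (simp add: set_borel_measurable_def mult.assoc)
    have "AE t in lebesgue. t \<notin> nodes T N"
      by (intro AE_completion AE_not_in finite_imp_null_set_lborel) simp
    then show "AE t in lebesgue. t \<in> {0<..<T} \<longrightarrow> norm (g t * G t) \<le> norm (C * g t)"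
    proof (rule AE_mp, intro AE_I2 impI)
      fix t assume "t \<notin> nodes T N" "t \<in> {0<..<T}"
      then have "\<bar>G t\<bar> \<le> \<bar>C\<bar>" using GC[of t] by auto
      then show "norm (g t * G t) \<le> norm (C * g t)"
        by (simp add: abs_mult mult.commute[of "\<bar>g t\<bar>"] mult_right_mono)
    qed
  qed
  then show ?thesis
    using set_integral_finite_difference(1)[of "nodes T N" "{0<..<T}" "\<lambda>t. g t * w t" "\<lambda>t. g t * G t"] wG
    by simp
qed

lemma spline_set_integrable:
  fixes w :: "real \<Rightarrow> real"
  assumes "T > 0" "N \<ge> 1" "w \<in> spline T N q"
  shows "set_integrable lebesgue {0<..<T} w"
  using set_integrable_mult_spline[OF assms(1,2) set_integrable_const[of 0 T 1] assms(3)] by simp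

lemma ipR_finite_difference:
  assumes "finite X" "\<And>t. t \<in> {0<..<T} - X \<Longrightarrow> f t = f' t" "\<And>t. t \<in> {0<..<T} - X \<Longrightarrow> g t = g' t"
  shows "ipR T f g = ipR T f' g'"
  unfolding ipR_def using assms by (intro set_integral_finite_difference[of X]) auto

text \<open>As \<open>p \<ge> 1\<close>, the product \<open>v t * x t\<close> is continuous on
  \<open>[0,T]\<close>, and it is differentiable off the finitely many nodes; the fundamental
  theorem tolerates such exceptions.\<close>

lemma ipR_integration_by_parts:
  assumes T: "T > 0" "N \<ge> 1" and p: "p \<ge> 1"
    and v: "v \<in> spline T N p" and x: "x \<in> spline T N p"
  shows "ipR T v (dt T x) + ipR T (dt T v) x = v T * x T - v 0 * x 0"
proof -
  let ?I = "{0<..<T}"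
  have i1: "set_integrable lebesgue ?I (\<lambda>t. v t * dt T x t)"
    by (rule set_integrable_mult_spline[OF T spline_set_integrable[OF T v] dt_in_spline[OF T(1) p x]])
  have i2: "set_integrable lebesgue ?I (\<lambda>t. dt T v t * x t)"
    by (rule set_integrable_mult_spline[OF T spline_set_integrable[OF T dt_in_spline[OF T(1) p v]] x])
  have "((\<lambda>t. v t * dt T x t + dt T v t * x t) has_integral (v T * x T - v 0 * x 0)) {0..T}"
  proof (rule fundamental_theorem_of_calculus_interior_strong[of "nodes T N"])
    show "continuous_on {0..T} (\<lambda>t. v t * x t)"
      using v x p by (intro continuous_on_mult) (auto intro: spline_continuous_on)
    show "((\<lambda>t. v t * x t) has_vector_derivative v t * dt T x t + dt T v t * x t) (at t)"
      if "t \<in> {0<..<T} - nodes T N" for t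
      by (intro has_vector_derivative_mult spline_has_vector_derivative[OF T v]
          spline_has_vector_derivative[OF T x] that)
  qed (use T in auto)
  then have "integral ?I (\<lambda>t. v t * dt T x t + dt T v t * x t) = v T * x T - v 0 * x 0"
    by (simp add: has_integral_Icc_iff_Ioo integral_unique)
  \<comment> \<open>The fundamental theorem concerns the gauge integral, \<open>ipR\<close> the
    Lebesgue integral; they agree because both products are Lebesgue integrable.\<close>
  moreover have "ipR T v (dt T x) + ipR T (dt T v) x =
      integral ?I (\<lambda>t. v t * dt T x t + dt T v t * x t)"
    unfolding ipR_def set_integral_add(2)[OF i1 i2, symmetric]
    by (rule set_lebesgue_integral_eq_integral(2)[OF set_integral_add(1)[OF i1 i2]])
  ultimately show ?thesis by simp
qed

section \<open>Primitives of splines\<close>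

text \<open>Termwise integration of the coefficients; characteristic 0 permits the division by
  \<open>Suc i\<close>.\<close>

lemma pderiv_surj:
  fixes P :: "'a::field_char_0 poly"
  obtains Q where "pderiv Q = P" "degree Q \<le> Suc (degree P)"
proof
  define Q where "Q = (\<Sum>i\<le>degree P. monom (coeff P i / of_nat (Suc i)) (Suc i))"
  have "pderiv Q = (\<Sum>i\<le>degree P. monom (coeff P i) i)"
    unfolding Q_def using higher_pderiv_sum[of 1 "\<lambda>i. monom (coeff P i / of_nat (Suc i)) (Suc i)" "{..degree P}"]
    by (simp add: pderiv_monom del: of_nat_Suc)
  also have "\<dots> = P" by (rule poly_as_sum_of_monoms)
  finally show "pderiv Q = P" .
  show "degree Q \<le> Suc (degree P)"
    unfolding Q_def by (intro degree_sum_le) (auto intro: order_trans[OF degree_monom_le])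
qed

lemma spline_primitive:
  fixes x :: "real \<Rightarrow> real"
  assumes T: "T > 0" "N \<ge> 1" and p: "p \<ge> 1" and x: "x \<in> spline T N (p - 1)"
  obtains X where "X \<in> spline_final T N p" "\<And>t. t \<in> {0<..<T} - nodes T N \<Longrightarrow> dt T X t = x t"
proof
  \<comment> \<open>Subtracting the full integral normalises the primitive to
    \<open>X T = 0\<close>.\<close>
  define X where "X t = integral {0..t} x - integral {0..T} x" for t
  have int: "x integrable_on {0..T}"
    using set_lebesgue_integral_eq_integral(1)[OF spline_set_integrable[OF T x]]
    by (simp add: integrable_on_Icc_iff_Ioo)
  have deriv_piece: "(X has_vector_derivative x t) (at t)" if j: "j \<in> {1..N}" and t: "t \<in> piece T N j" for j t
  proof -
    obtain P where P: "\<And>t. t \<in> piece T N j \<Longrightarrow> x t = poly P t"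
      using spline_piece[OF x j] by (metis of_real_eq_id id_apply)
    have t': "t \<in> {0<..<T}" using piece_subset[OF T(1) j] t by auto
    \<comment> \<open>Inside a piece \<open>x\<close> agrees locally with a polynomial, hence is
      continuous there, and its indefinite integral is differentiable with derivative
      \<open>x t\<close>.\<close>
    have "isCont (\<lambda>t. poly P t) t" by simp
    moreover have "eventually (\<lambda>s. s \<in> piece T N j) (nhds t)"
      using t by (intro eventually_nhds_in_open) auto
    then have "eventually (\<lambda>s. poly P s = x s) (nhds t)"
      by eventually_elim (use P in auto)
    ultimately have "isCont x t" using isCont_cong by blast
    then have "((\<lambda>u. integral {0..u} x) has_vector_derivative x t) (at t within {0..T})"
      using integral_has_vector_derivative_continuous_at[OF int, of t "{}"] t'
      by (auto intro: continuous_at_imp_continuous_within)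
    moreover have "at t within {0..T} = at t" using t' by (intro at_within_interior) auto
    ultimately show ?thesis
      unfolding X_def by (auto intro!: derivative_eq_intros)
  qed
  show "dt T X t = x t" if t: "t \<in> {0<..<T} - nodes T N" for t
    using t T deriv_piece[OF piece_index[OF T t]]
    by (intro dt_eqI) (auto intro: has_vector_derivative_at_within)
  have poly: "\<exists>Q :: real poly. degree Q \<le> p \<and> (\<forall>t\<in>piece T N j. X t = poly Q (of_real t))"
    if j: "j \<in> {1..N}" for j
  proof -
    obtain P where P: "degree P \<le> p - 1" "\<And>t. t \<in> piece T N j \<Longrightarrow> x t = poly P t"
      using spline_piece[OF x j] by (metis of_real_eq_id id_apply)
    obtain Q where Q: "pderiv Q = P" "degree Q \<le> Suc (degree P)"
      by (rule pderiv_surj)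
    \<comment> \<open>\<open>X\<close> and \<open>Q\<close> have equal derivatives on an interval,
      so they differ by a constant \<open>c\<close>, and \<open>X\<close> is the polynomial
      \<open>Q + [:c:]\<close> there.\<close>
    have "((\<lambda>t. X t - poly Q t) has_field_derivative 0) (at t within piece T N j)"
      if t: "t \<in> piece T N j" for t
    proof -
      have "(X has_field_derivative poly P t) (at t)"
        using deriv_piece[OF j t] P(2)[OF t] by (simp add: has_real_derivative_iff_has_vector_derivative)
      then have "((\<lambda>t. X t - poly Q t) has_field_derivative poly P t - poly (pderiv Q) t) (at t)"
        by (intro DERIV_diff poly_DERIV)
      then show ?thesis using Q(1) by (simp add: has_field_derivative_at_within)
    qed
    then obtain c where "\<forall>t\<in>piece T N j. X t - poly Q t = c"
      using has_field_derivative_zero_constant[of "piece T N j" "\<lambda>t. X t - poly Q t"] by auto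
    then have "\<forall>t\<in>piece T N j. X t = poly (Q + [:c:]) t" by (auto simp: algebra_simps)
    moreover have "degree (Q + [:c:]) \<le> p"
      using P(1) Q(2) p by (intro degree_add_le) auto
    ultimately show ?thesis by auto
  qed
  have "Ck_on (p - 1) {0..T} X"
  \<comment> \<open>For \<open>p = 1\<close> the function \<open>x\<close> may jump at nodes, and
    only continuity of \<open>X\<close> is required. For \<open>p > 1\<close> it is continuous, so
    it is the derivative of \<open>X\<close> on all of \<open>[0,T]\<close> and supplies the
    remaining smoothness.\<close>
  proof (cases "p = 1")
    case True
    then show ?thesis
      unfolding X_def
      by (auto intro!: continuous_intros indefinite_integral_continuous_1 int)
  next
    case False
    then have "continuous_on {0..T} x" and ck: "Ck_on (p - 1 - 1) {0..T} x"
      using p x spline_continuous_on[OF x] by (auto simp: spline_def)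
    then have "(X has_vector_derivative x t) (at t within {0..T})" if "t \<in> {0..T}" for t
      unfolding X_def using integral_has_vector_derivative[of 0 T x t] that
      by (auto intro!: derivative_eq_intros)
    then have "Ck_on (Suc (p - 1 - 1)) {0..T} X" using ck unfolding Ck_on.simps by blast
    moreover have "Suc (p - 1 - 1) = p - 1" using False p by simp
    ultimately show ?thesis by metis
  qed
  with poly show "X \<in> spline_final T N p"
    by (simp add: spline_final_def spline_def X_def)
qed

section \<open>Complex splines\<close>

text \<open>Differentiation acts componentwise, so the derivative witness splits into real and
  imaginary parts or is reassembled by \<open>Complex\<close> at each level of the
  induction.\<close>

lemma Ck_on_complex_iff:
  "Ck_on k S f \<longleftrightarrow> Ck_on k S (\<lambda>t. Re (f t)) \<and> Ck_on k S (\<lambda>t. Im (f t))"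
proof (induction k arbitrary: f)
  case 0
  show ?case
    using continuous_on_Complex[of S "\<lambda>t. Re (f t)" "\<lambda>t. Im (f t)"]
    by (auto intro: continuous_intros)
next
  case (Suc k)
  have hvd: "(f has_vector_derivative d) (at t within S) \<longleftrightarrow>
     ((\<lambda>t. Re (f t)) has_vector_derivative Re d) (at t within S) \<and>
     ((\<lambda>t. Im (f t)) has_vector_derivative Im d) (at t within S)" for d t
    by (simp add: has_vector_derivative_complex_iff has_real_derivative_iff_has_vector_derivative)
  show ?case (is "?L \<longleftrightarrow> ?R")
  proof
    assume ?L
    then obtain f' where "\<forall>t\<in>S. (f has_vector_derivative f' t) (at t within S)" "Ck_on k S f'"
      by auto
    then show ?R
      unfolding Ck_on.simps hvd Suc[of f']
      by (intro conjI exI[of _ "\<lambda>t. Re (f' t)"] exI[of _ "\<lambda>t. Im (f' t)"]) auto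
  next
    assume ?R
    then obtain a b where
      "\<forall>t\<in>S. ((\<lambda>t. Re (f t)) has_vector_derivative a t) (at t within S)" "Ck_on k S a"
      "\<forall>t\<in>S. ((\<lambda>t. Im (f t)) has_vector_derivative b t) (at t within S)" "Ck_on k S b"
      by auto
    then show ?L
      by (auto simp: hvd Suc intro!: exI[of _ "\<lambda>t. Complex (a t) (b t)"])
  qed
qed

text \<open>Powers of a real argument are real, so taking the real part affects the coefficients
  only.\<close>

lemma Re_poly_of_real: "Re (poly P (of_real t)) = poly (map_poly Re P) t"
  by (induction P) (auto simp: map_poly_pCons)

lemma Im_poly_of_real: "Im (poly P (of_real t)) = poly (map_poly Im P) t"
  by (induction P) (auto simp: map_poly_pCons)

lemma poly_map_poly_of_real: "poly (map_poly of_real P) (of_real t) = complex_of_real (poly P t)"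
  by (induction P) (auto simp: map_poly_pCons)

text \<open>Polynomials split coefficientwise without raising the degree; conversely real pieces
  \<open>A\<close> and \<open>B\<close> combine to \<open>A + \<i> B\<close>.\<close>

lemma spline_complex_iff:
  "f \<in> spline T N q \<longleftrightarrow> (\<lambda>t. Re (f t)) \<in> spline T N q \<and> (\<lambda>t. Im (f t)) \<in> spline T N q"
proof -
  have "(\<exists>P :: complex poly. degree P \<le> q \<and> (\<forall>t\<in>S. f t = poly P (of_real t))) \<longleftrightarrow>
      (\<exists>P :: real poly. degree P \<le> q \<and> (\<forall>t\<in>S. Re (f t) = poly P (of_real t))) \<and>
      (\<exists>P :: real poly. degree P \<le> q \<and> (\<forall>t\<in>S. Im (f t) = poly P (of_real t)))"
    (is "?L \<longleftrightarrow> ?R") for S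
  proof
    assume ?L
    then obtain P where P: "degree P \<le> q" "\<forall>t\<in>S. f t = poly P (of_real t)" by blast
    then have "degree (map_poly Re P) \<le> q" "degree (map_poly Im P) \<le> q"
      using map_poly_degree_leq order_trans by blast+
    then show ?R using P(2) by (auto simp: Re_poly_of_real Im_poly_of_real)
  next
    assume ?R
    then obtain A B :: "real poly" where AB: "degree A \<le> q" "\<forall>t\<in>S. Re (f t) = poly A t"
      "degree B \<le> q" "\<forall>t\<in>S. Im (f t) = poly B t" by auto
    let ?P = "map_poly complex_of_real A + smult \<i> (map_poly complex_of_real B)"
    have "degree ?P \<le> q"
      using AB by (intro degree_add_le order_trans[OF degree_smult_le])
        (auto intro: order_trans[OF map_poly_degree_leq])
    moreover have "\<forall>t\<in>S. f t = poly ?P (of_real t)"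
      using AB by (auto simp: poly_map_poly_of_real complex_eq_iff)
    ultimately show ?L by blast
  qed
  then show ?thesis
    by (auto simp: spline_def Ck_on_complex_iff[of _ _ f])
qed

lemma spline_zero: "(\<lambda>t. 0) \<in> spline T N q"
proof -
  have "Ck_on k S (\<lambda>t. 0 :: 'a)" for k S
    by (induction k) (auto intro!: exI[of _ "\<lambda>t. 0"])
  then show ?thesis by (auto simp: spline_def intro!: exI[of _ 0])
qed

text \<open>Makes real test functions admissible in the complex problem.\<close>

lemma spline_of_real:
  "x \<in> spline T N q \<Longrightarrow> (\<lambda>t. complex_of_real (x t)) \<in> spline T N q"
  by (subst spline_complex_iff) (simp add: spline_zero)

text \<open>Expands \<open>(gr + \<i> gi) * cnj w\<close>; integrability of the four real products
  allows the integral to be split. The finite set \<open>X\<close> absorbs the nodes when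
  \<open>g\<close> is a derivative.\<close>

lemma ipC_eq_Complex:
  assumes T: "T > 0" "N \<ge> 1" and gr: "set_integrable lebesgue {0<..<T} gr"
    and gi: "set_integrable lebesgue {0<..<T} gi"
    and g: "\<And>t. t \<in> {0<..<T} - X \<Longrightarrow> g t = Complex (gr t) (gi t)" and X: "finite X"
    and w: "w \<in> spline T N q"
  shows "ipC T g w = Complex (ipR T gr (\<lambda>t. Re (w t)) + ipR T gi (\<lambda>t. Im (w t)))
    (ipR T gi (\<lambda>t. Re (w t)) - ipR T gr (\<lambda>t. Im (w t)))"
proof -
  let ?I = "{0<..<T}"
  have w': "(\<lambda>t. Re (w t)) \<in> spline T N q" "(\<lambda>t. Im (w t)) \<in> spline T N q"
    using w spline_complex_iff by blast+
  note i = set_integrable_mult_spline[OF T gr w'(1)] set_integrable_mult_spline[OF T gr w'(2)]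
    set_integrable_mult_spline[OF T gi w'(1)] set_integrable_mult_spline[OF T gi w'(2)]
  define a where "a t = gr t * Re (w t) + gi t * Im (w t)" for t
  define b where "b t = gi t * Re (w t) - gr t * Im (w t)" for t
  have ia: "set_integrable lebesgue ?I a" unfolding a_def using i by (intro set_integral_add)
  have ib: "set_integrable lebesgue ?I b" unfolding b_def using i by (intro set_integral_diff)
  have ia': "set_integrable lebesgue ?I (\<lambda>t. complex_of_real (a t))"
    using ia unfolding set_integrable_def
    by (simp add: scaleR_conv_of_real flip: of_real_mult)
  have ib': "set_integrable lebesgue ?I (\<lambda>t. \<i> * complex_of_real (b t))"
    using ib unfolding set_integrable_def
    by (simp add: scaleR_conv_of_real mult.left_commute[of _ \<i>] flip: of_real_mult)
  have "ipC T g w = set_lebesgue_integral lebesgue ?I (\<lambda>t. of_real (a t) + \<i> * of_real (b t))"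
    unfolding ipC_def
    by (rule set_integral_finite_difference[OF X])
      (auto simp: g a_def b_def complex_eq_iff algebra_simps)
  also have "\<dots> = of_real (set_lebesgue_integral lebesgue ?I a) + \<i> * of_real (set_lebesgue_integral lebesgue ?I b)"
    using ia' ib' by (simp add: set_integral_add set_integral_complex_of_real)
  finally show ?thesis
    unfolding ipR_def set_integral_add(2)[OF i(1,4), symmetric] set_integral_diff(2)[OF i(3,2), symmetric]
    by (simp add: complex_eq_iff flip: a_def b_def)
qed

lemma L2_on_set_integrable:
  assumes "L2_on T f"
  shows "set_integrable lebesgue {0<..<T} f"
proof (rule set_integrable_bound)
  show "set_integrable lebesgue {0<..<T} (\<lambda>t. 1 + (norm (f t))\<^sup>2)"
    using assms unfolding L2_on_def
    by (intro set_integral_add set_integrable_const) simp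
  show "set_borel_measurable lebesgue {0<..<T} f"
    using assms by (simp add: L2_on_def)
  \<comment> \<open>From \<open>(s - 1/2)\<^sup>2 \<ge> 0\<close>. The dominating function is
    integrable because the interval has finite measure.\<close>
  have "s \<le> 1 + s\<^sup>2" for s :: real
    using sum_power2_ge_zero[of "s - 1/2" 0] by (simp add: power2_eq_square algebra_simps)
  then show "AE t in lebesgue. t \<in> {0<..<T} \<longrightarrow> norm (f t) \<le> norm (1 + (norm (f t))\<^sup>2)"
    by (intro AE_I2) (metis abs_ge_self order_trans real_norm_def)
qed

section \<open>The equivalences\<close>

lemma real_solution_iff_dt:
  assumes T: "T > 0" "N \<ge> 1" and p: "p \<ge> 1"
  shows "real_solution T N p \<mu> f_r f_i u v \<longleftrightarrow> real_solution_dt T N p \<mu> f_r f_i u v"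
\<comment> \<open>Both systems contain the membership of \<open>u\<close> and \<open>v\<close>, so
  both fail without it.\<close>
proof (cases "u \<in> spline_init T N p \<and> v \<in> spline_init T N p")
  case False
  then show ?thesis by (auto simp: real_solution_def real_solution_dt_def)
next
  case True
  have parts: "ipR T z (dt T x) = - ipR T (dt T z) x"
    if "z \<in> spline_init T N p" "x \<in> spline_final T N p" for z x
    using ipR_integration_by_parts[OF T p, of z x] that
    by (auto simp: spline_init_def spline_final_def)
  \<comment> \<open>Transfers test conditions along \<open>dt\<close>. A primitive recovers
    \<open>x\<close> only off the nodes, so \<open>Q\<close> must be insensitive to node
    values.\<close>
  have "(\<forall>x\<in>spline T N (p - 1). Q x) \<longleftrightarrow> (\<forall>x\<in>spline_final T N p. Q (dt T x))"
    if Q: "\<And>x y. (\<And>t. t \<in> {0<..<T} - nodes T N \<Longrightarrow> x t = y t) \<Longrightarrow> Q x \<Longrightarrow> Q y"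
    for Q :: "(real \<Rightarrow> real) \<Rightarrow> bool"
  proof
    assume "\<forall>x\<in>spline T N (p - 1). Q x"
    then show "\<forall>x\<in>spline_final T N p. Q (dt T x)"
      using dt_in_spline[OF T(1) p] by (auto simp: spline_final_def)
  next
    assume *: "\<forall>x\<in>spline_final T N p. Q (dt T x)"
    show "\<forall>x\<in>spline T N (p - 1). Q x"
    proof
      fix x :: "real \<Rightarrow> real" assume "x \<in> spline T N (p - 1)"
      then obtain X where "X \<in> spline_final T N p"
        "\<And>t. t \<in> {0<..<T} - nodes T N \<Longrightarrow> dt T X t = x t"
        using spline_primitive[OF T p] by blast
      then show "Q x" using * Q[of "dt T X" x] by blast
    qed
  qed
  note range = this
  have ip: "ipR T g x = ipR T g y" if "\<And>t. t \<in> {0<..<T} - nodes T N \<Longrightarrow> x t = y t" for g x y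
    using that by (intro ipR_finite_difference[of "nodes T N"]) auto
  \<comment> \<open>One generic equation serves both lines of the system: \<open>m = \<mu>\<close>,
    \<open>g = f_i\<close> for the first, \<open>m = - \<mu>\<close>, \<open>g = - f_r\<close> for
    the second.\<close>
  have equiv: "(\<forall>x\<in>spline T N (p - 1). ipR T a x + m * ipR T z x = ipR T g x) \<longleftrightarrow>
      (\<forall>x\<in>spline_final T N p. ipR T a (dt T x) - m * ipR T (dt T z) x = ipR T g (dt T x))"
    if z: "z \<in> spline_init T N p" for a z g m
  proof -
    have "(\<forall>x\<in>spline T N (p - 1). ipR T a x + m * ipR T z x = ipR T g x) \<longleftrightarrow>
        (\<forall>x\<in>spline_final T N p. ipR T a (dt T x) + m * ipR T z (dt T x) = ipR T g (dt T x))"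
    proof (rule range)
      fix x y :: "real \<Rightarrow> real"
      assume "\<And>t. t \<in> {0<..<T} - nodes T N \<Longrightarrow> x t = y t"
      from ip[OF this] show "ipR T a x + m * ipR T z x = ipR T g x \<Longrightarrow>
          ipR T a y + m * ipR T z y = ipR T g y"
        by simp
    qed
    also have "\<dots> \<longleftrightarrow> (\<forall>x\<in>spline_final T N p.
        ipR T a (dt T x) - m * ipR T (dt T z) x = ipR T g (dt T x))"
      by (intro ball_cong refl) (simp add: parts[OF z])
    finally show ?thesis .
  qed
  have neg: "ipR T (\<lambda>t. - f_r t) x = - ipR T f_r x" for x
    by (simp add: ipR_def set_lebesgue_integral_def)
  show ?thesis
    using True equiv[of v "dt T u" \<mu> f_i] equiv[of u "dt T v" "- \<mu>" "\<lambda>t. - f_r t"]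
    unfolding real_solution_def real_solution_dt_def neg by simp
qed

lemma complex_solution_iff_real:
  assumes T: "T > 0" "N \<ge> 1" and p: "p \<ge> 1" and L2: "L2_on T f"
    and f: "\<And>t. t \<in> {0<..<T} \<Longrightarrow> f t = complex_of_real (f_r t) + \<i> * complex_of_real (f_i t)"
    and \<psi>: "\<And>t. t \<in> {0..T} \<Longrightarrow> \<psi> t = complex_of_real (u t) + \<i> * complex_of_real (v t)"
  shows "complex_solution T N p \<mu> f \<psi> \<longleftrightarrow> real_solution T N p \<mu> f_r f_i u v"
proof -
  have "\<psi> \<in> spline T N p \<longleftrightarrow> u \<in> spline T N p \<and> v \<in> spline T N p"
    unfolding spline_complex_iff[of \<psi>] using \<psi>
    by (intro arg_cong2[of _ _ _ _ conj] spline_cong[OF T(1)]) auto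
  then have init: "\<psi> \<in> spline_init T N p \<longleftrightarrow> u \<in> spline_init T N p \<and> v \<in> spline_init T N p"
    using \<psi>[of 0] T by (auto simp: spline_init_def complex_eq_iff)
  show ?thesis
  proof (cases "u \<in> spline_init T N p \<and> v \<in> spline_init T N p")
    case False
    then show ?thesis using init by (auto simp: complex_solution_def real_solution_def)
  next
    case True
    then have uv: "u \<in> spline T N p" "v \<in> spline T N p" by (auto simp: spline_init_def)
    note du = spline_has_vector_derivative[OF T uv(1)] and dv = spline_has_vector_derivative[OF T uv(2)]
    \<comment> \<open>Claimed off the nodes only, since at a node a spline of degree 1 need not be
      differentiable.\<close>
    have d\<psi>: "dt T \<psi> t = Complex (dt T u t) (dt T v t)" if t: "t \<in> {0<..<T} - nodes T N" for t
    proof -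
      have "((\<lambda>t. complex_of_real (u t) + \<i> * complex_of_real (v t)) has_vector_derivative
          Complex (dt T u t) (dt T v t)) (at t)"
        using du[OF t] dv[OF t]
        by (simp add: has_vector_derivative_complex_iff has_real_derivative_iff_has_vector_derivative)
      then have "(\<psi> has_vector_derivative Complex (dt T u t) (dt T v t)) (at t)"
        by (rule has_vector_derivative_transform_within_open[of _ _ _ "{0<..<T}"]) (use t \<psi> in auto)
      then have "(\<psi> has_vector_derivative Complex (dt T u t) (dt T v t)) (at t within {0..T})"
        by (rule has_vector_derivative_at_within)
      then show ?thesis
        using T t by (intro dt_eqI) auto
    qed
    have fi: "set_integrable lebesgue {0<..<T} f_r" "set_integrable lebesgue {0<..<T} f_i"
    proof -
      note fi = L2_on_set_integrable[OF L2, unfolded set_integrable_def]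
      \<comment> \<open>The decomposition of \<open>f\<close> holds on \<open>(0,T)\<close> only, so
        the indicator is kept before taking parts.\<close>
      have eq: "indicator {0<..<T} t *\<^sub>R f_r t = Re (indicator {0<..<T} t *\<^sub>R f t)"
        "indicator {0<..<T} t *\<^sub>R f_i t = Im (indicator {0<..<T} t *\<^sub>R f t)" for t
        by (auto simp: f indicator_def)
      show "set_integrable lebesgue {0<..<T} f_r" "set_integrable lebesgue {0<..<T} f_i"
        unfolding set_integrable_def eq by (rule integrable_Re[OF fi] integrable_Im[OF fi])+
    qed
    note dint = spline_set_integrable[OF T dt_in_spline[OF T(1) p uv(1)]]
      spline_set_integrable[OF T dt_in_spline[OF T(1) p uv(2)]]
    \<comment> \<open>Since \<open>\<i>\<close> interchanges the parts, the real part is the first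
      real equation tested with \<open>b\<close> minus the second tested with \<open>a\<close>; the
      imaginary part is the first tested with \<open>a\<close> plus the second tested with
      \<open>b\<close>.\<close>
    have ips: "\<i> * ipC T (dt T \<psi>) w + complex_of_real \<mu> * ipC T \<psi> w = ipC T f w \<longleftrightarrow>
        - (ipR T (dt T v) a - ipR T (dt T u) b) + \<mu> * (ipR T u a + ipR T v b) = ipR T f_r a + ipR T f_i b \<and>
        ipR T (dt T u) a + ipR T (dt T v) b + \<mu> * (ipR T v a - ipR T u b) = ipR T f_i a - ipR T f_r b"
      if w: "w \<in> spline T N (p - 1)" and ab: "a = (\<lambda>t. Re (w t))" "b = (\<lambda>t. Im (w t))" for w a b
    proof -
      have "ipC T (dt T \<psi>) w = Complex (ipR T (dt T u) a + ipR T (dt T v) b) (ipR T (dt T v) a - ipR T (dt T u) b)"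
        unfolding ab by (rule ipC_eq_Complex[OF T dint d\<psi> _ w]) auto
      moreover have "ipC T \<psi> w = Complex (ipR T u a + ipR T v b) (ipR T v a - ipR T u b)"
        unfolding ab
        by (rule ipC_eq_Complex[OF T spline_set_integrable[OF T uv(1)] spline_set_integrable[OF T uv(2)] _ finite.emptyI w])
          (auto simp: \<psi> complex_eq_iff)
      moreover have "ipC T f w = Complex (ipR T f_r a + ipR T f_i b) (ipR T f_i a - ipR T f_r b)"
        unfolding ab by (rule ipC_eq_Complex[OF T fi _ finite.emptyI w]) (auto simp: f complex_eq_iff)
      ultimately show ?thesis by (simp add: complex_eq_iff)
    qed
    have "(\<forall>w\<in>spline T N (p - 1). \<i> * ipC T (dt T \<psi>) w + complex_of_real \<mu> * ipC T \<psi> w = ipC T f w) \<longleftrightarrow>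
      (\<forall>x\<in>spline T N (p - 1). ipR T (dt T u) x + \<mu> * ipR T v x = ipR T f_i x) \<and>
      (\<forall>y\<in>spline T N (p - 1). ipR T (dt T v) y - \<mu> * ipR T u y = - ipR T f_r y)" (is "?L \<longleftrightarrow> ?R")
    proof
      assume L: ?L
      have zero: "ipR T g (\<lambda>t. 0) = 0" for g by (simp add: ipR_def)
      \<comment> \<open>A real test function means \<open>b = 0\<close>, which decouples the two
        combinations.\<close>
      have "ipR T (dt T u) x + \<mu> * ipR T v x = ipR T f_i x \<and> ipR T (dt T v) x - \<mu> * ipR T u x = - ipR T f_r x"
        if x: "x \<in> spline T N (p - 1)" for x
        using ips[OF spline_of_real[OF x], of x "\<lambda>t. 0"] L spline_of_real[OF x] zero by simp
      then show ?R by blast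
    next
      assume R: ?R
      show ?L
      proof
        fix w :: "real \<Rightarrow> complex" assume w: "w \<in> spline T N (p - 1)"
        let ?a = "\<lambda>t. Re (w t)" and ?b = "\<lambda>t. Im (w t)"
        have "?a \<in> spline T N (p - 1)" "?b \<in> spline T N (p - 1)"
          using w spline_complex_iff by blast+
        with R have "ipR T (dt T u) ?a + \<mu> * ipR T v ?a = ipR T f_i ?a"
          "ipR T (dt T v) ?a - \<mu> * ipR T u ?a = - ipR T f_r ?a"
          "ipR T (dt T u) ?b + \<mu> * ipR T v ?b = ipR T f_i ?b"
          "ipR T (dt T v) ?b - \<mu> * ipR T u ?b = - ipR T f_r ?b"
          by blast+
        then show "\<i> * ipC T (dt T \<psi>) w + complex_of_real \<mu> * ipC T \<psi> w = ipC T f w"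
          unfolding ips[OF w refl refl] by (simp add: algebra_simps)
      qed
    qed
    then show ?thesis using True init by (simp add: complex_solution_def real_solution_def)
  qed
qed

theorem proposition4p2:
  fixes T \<mu> :: real and p N :: nat
    and f \<psi> :: "real \<Rightarrow> complex"
    and f_r f_i u v :: "real \<Rightarrow> real"
  assumes "T > 0" and "p \<ge> 1" and "N \<ge> 1"
    and "L2_on T f"
    and "\<And>t. t \<in> {0<..<T} \<Longrightarrow> f t = complex_of_real (f_r t) + \<i> * complex_of_real (f_i t)"
    and "\<And>t. t \<in> {0..T} \<Longrightarrow> \<psi> t = complex_of_real (u t) + \<i> * complex_of_real (v t)"
  shows "(complex_solution T N p \<mu> f \<psi> \<longleftrightarrow> real_solution T N p \<mu> f_r f_i u v) \<and>
         (real_solution T N p \<mu> f_r f_i u v \<longleftrightarrow> real_solution_dt T N p \<mu> f_r f_i u v)"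
proof
  show "complex_solution T N p \<mu> f \<psi> \<longleftrightarrow> real_solution T N p \<mu> f_r f_i u v"
    using assms by (intro complex_solution_iff_real)
  show "real_solution T N p \<mu> f_r f_i u v \<longleftrightarrow> real_solution_dt T N p \<mu> f_r f_i u v"
    using assms by (intro real_solution_iff_dt)
qed

end
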